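(* Let $T$, $\widehat T$ be as described in the context. If $\{T\}'x$ is dense in $\mathcal H_1\oplus\mathcal H_2$ for every nonzero $x\in\mathcal H_1$, then the linear manifold $\mathcal L_{3,1}=\{Q_{3,1}:Q=[Q_{i,j}]_{i,j=1}^3\in\{\widehat T\}'\}\subset\mathcal L(\mathcal H)$ is transitive.
   Context: $\mathcal L(\mathcal H)$ denotes the bounded linear operators on a complex Hilbert space $\mathcal H$ and $\{R\}'$ the commutant of $R$. A linear manifold $\mathcal N\subset\mathcal L(\mathcal H)$ is transitive if $\{Xh:X\in\mathcal N\}$ is dense in $\mathcal H$ for every nonzero $h\in\mathcal H$. $\mathcal H_1$ is identified with $\mathcal H_1\oplus\{0\}$. Let $T=\begin{bmatrix}A&C\\ 0&B\end{bmatrix}\in\mathcal L(\mathcal H_1\oplus\mathcal H_2)$ with $\dim\mathcal H_1=\dim\mathcal H_2=\aleph_0$. Let $\mathcal H$ be a Hilbert space with orthonormal basis $\{e_k\}_{k=1}^\infty$, $(e\otimes f)h=\langle h,f\rangle e$, and $S=\sum_{k\ge1}e_{k+1}\otimes e_k$ the simple unilateral shift. Assume $A$ is similar to $S$, and let $V:\mathcal H\to\mathcal H_1$ be bounded and invertible with $VS=AV$. Let $\mu_0\in\partial\sigma(B)$, and let $\{\mu_k\}_{k\ge1}$ be distinct nonzero complex numbers in the resolvent set of $B$ converging to $\mu_0$ (fast enough) such that $B-\mu_0I$ is similar to an operator $\widehat B=\begin{bmatrix}*&*\\ F_*&D_*\end{bmatrix}\in\mathcal L(\mathcal H\oplus\mathcal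 H)$, where $D_*=\sum_{k\ge1}(\mu_k-\mu_0)e_k\otimes e_k$ and $\operatorname{rank}F_*=1$; let $W:\mathcal H\oplus\mathcal H\to\mathcal H_2$ be bounded and invertible with $W\widehat B=(B-\mu_0I)W$. With $Z=V\oplus W$ put $\widehat T=Z^{-1}(T-\mu_0I)Z=\begin{bmatrix}S-\mu_0I&V^{-1}CW\\ 0&\widehat B\end{bmatrix}\in\mathcal L(\mathcal H\oplus\mathcal H\oplus\mathcal H)$; operators on $\mathcal H\oplus\mathcal H\oplus\mathcal H$ are written as $3\times3$ operator matrices. *)

theory Defs
  imports "HOL-Analysis.Analysis"
begin

class complex_vector = real_vector +
  fixes scaleC :: "complex \<Rightarrow> 'a \<Rightarrow> 'a" (infixr "*\<^sub>C" 75)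
  assumes scaleC_add_right: "a *\<^sub>C (x + y) = a *\<^sub>C x + a *\<^sub>C y"
    and scaleC_add_left: "(a + b) *\<^sub>C x = a *\<^sub>C x + b *\<^sub>C x"
    and scaleC_scaleC: "a *\<^sub>C (b *\<^sub>C x) = (a * b) *\<^sub>C x"
    and scaleC_one: "1 *\<^sub>C x = x"
    and scaleR_scaleC: "r *\<^sub>R x = complex_of_real r *\<^sub>C x"

global_interpretation complex_vector: vector_space "scaleC :: complex \<Rightarrow> 'a \<Rightarrow> 'a::complex_vector"
  by unfold_locales (simp_all add: scaleC_add_right scaleC_add_left scaleC_scaleC scaleC_one)

text \<open>The inner product is linear in the first argument. Positive definiteness is part of
  \<open>cinner_self\<close>, since the norm is that of a real normed vector space.\<close>

class complex_inner = complex_vector + real_normed_vector +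
  fixes cinner :: "'a \<Rightarrow> 'a \<Rightarrow> complex"
  assumes cinner_add_left: "cinner (x + y) z = cinner x z + cinner y z"
    and cinner_scaleC_left: "cinner (a *\<^sub>C x) y = a * cinner x y"
    and cinner_commute: "cinner x y = cnj (cinner y x)"
    and cinner_self: "cinner x x = complex_of_real ((norm x)\<^sup>2)"

class complex_hilbert = complex_inner + complete_space

text \<open>Orthogonal direct sums are product types; the library's norm on pairs is the Hilbertian one.\<close>

instantiation prod :: (complex_vector, complex_vector) complex_vector
begin

definition scaleC_prod :: "complex \<Rightarrow> 'a \<times> 'b \<Rightarrow> 'a \<times> 'b"
  where "scaleC_prod c p = (c *\<^sub>C fst p, c *\<^sub>C snd p)"

instance
  by standard
    (simp_all add: scaleC_prod_def prod_eq_iff scaleC_add_right scaleC_add_left scaleC_scaleC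
      scaleC_one scaleR_scaleC)

end

instantiation prod :: (complex_inner, complex_inner) complex_inner
begin

definition cinner_prod :: "'a \<times> 'b \<Rightarrow> 'a \<times> 'b \<Rightarrow> complex"
  where "cinner_prod p q = cinner (fst p) (fst q) + cinner (snd p) (snd q)"

instance
proof
  fix x y z :: "'a \<times> 'b" and a :: complex
  show "cinner (x + y) z = cinner x z + cinner y z"
    by (simp add: cinner_prod_def cinner_add_left)
  show "cinner (a *\<^sub>C x) y = a * cinner x y"
    by (simp add: cinner_prod_def scaleC_prod_def cinner_scaleC_left distrib_left)
  show "cinner x y = cnj (cinner y x)"
    unfolding cinner_prod_def complex_cnj_add
    using cinner_commute[of "fst x" "fst y"] cinner_commute[of "snd x" "snd y"] by simp
  show "cinner x x = complex_of_real ((norm x)\<^sup>2)"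
    by (simp add: cinner_prod_def cinner_self norm_prod_def)
qed

end

instance prod :: (complex_hilbert, complex_hilbert) complex_hilbert ..

definition orthonormal_basis :: "'i set \<Rightarrow> ('i \<Rightarrow> 'a::complex_inner) \<Rightarrow> bool"
  where "orthonormal_basis I e \<longleftrightarrow>
    (\<forall>i\<in>I. \<forall>j\<in>I. cinner (e i) (e j) = (if i = j then 1 else 0)) \<and>
    closure (complex_vector.span (e ` I)) = UNIV"

definition bounded_clinear :: "('a::complex_inner \<Rightarrow> 'b::complex_inner) \<Rightarrow> bool"
  where "bounded_clinear f \<longleftrightarrow> bounded_linear f \<and> (\<forall>c x. f (c *\<^sub>C x) = c *\<^sub>C f x)"

definition bounded_invertible :: "('a::complex_inner \<Rightarrow> 'b::complex_inner) \<Rightarrow> bool"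
  where "bounded_invertible f \<longleftrightarrow>
    bounded_clinear f \<and> (\<exists>g. bounded_clinear g \<and> g \<circ> f = id \<and> f \<circ> g = id)"

definition op_spectrum :: "('a::complex_inner \<Rightarrow> 'a) \<Rightarrow> complex set"
  where "op_spectrum R = {z. \<not> bounded_invertible (\<lambda>x. R x - z *\<^sub>C x)}"

definition resolvent_set :: "('a::complex_inner \<Rightarrow> 'a) \<Rightarrow> complex set"
  where "resolvent_set R = - op_spectrum R"

definition commutant :: "('a::complex_inner \<Rightarrow> 'a) \<Rightarrow> ('a \<Rightarrow> 'a) set"
  where "commutant R = {Q. bounded_clinear Q \<and> Q \<circ> R = R \<circ> Q}"

definition op_linear_manifold :: "('a::complex_inner \<Rightarrow> 'a) set \<Rightarrow> bool"
  where "op_linear_manifold N \<longleftrightarrow>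
    N \<subseteq> Collect bounded_clinear \<and> (\<lambda>x. 0) \<in> N \<and>
    (\<forall>X\<in>N. \<forall>Y\<in>N. (\<lambda>x. X x + Y x) \<in> N) \<and>
    (\<forall>c. \<forall>X\<in>N. (\<lambda>x. c *\<^sub>C X x) \<in> N)"

definition transitive_manifold :: "('a::complex_inner \<Rightarrow> 'a) set \<Rightarrow> bool"
  where "transitive_manifold N \<longleftrightarrow>
    op_linear_manifold N \<and> (\<forall>h. h \<noteq> 0 \<longrightarrow> closure {X h | X. X \<in> N} = UNIV)"

text \<open>\<open>tensor_op u v\<close> is \<open>u \<otimes> v\<close>.\<close>

definition tensor_op :: "'a::complex_inner \<Rightarrow> 'a \<Rightarrow> 'a \<Rightarrow> 'a"
  where "tensor_op u v h = cinner h v *\<^sub>C u"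

text \<open>For a basis \<open>e\<close> indexed by \<open>{1..}\<close>, and bounded \<open>d\<close>, the operator series below converge
  unconditionally in the strong operator topology.\<close>

definition unilateral_shift :: "(nat \<Rightarrow> 'a::complex_inner) \<Rightarrow> 'a \<Rightarrow> 'a"
  where "unilateral_shift e h = (\<Sum>\<^sub>\<infinity>k\<in>{1..}. tensor_op (e (k + 1)) (e k) h)"

definition diagonal_op :: "(nat \<Rightarrow> 'a::complex_inner) \<Rightarrow> (nat \<Rightarrow> complex) \<Rightarrow> 'a \<Rightarrow> 'a"
  where "diagonal_op e d h = (\<Sum>\<^sub>\<infinity>k\<in>{1..}. d k *\<^sub>C tensor_op (e k) (e k) h)"

text \<open>\<open>dim\<close> is \<open>0\<close> on infinite-dimensional spaces, so only nonzero values of \<open>op_rank\<close> are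
  unambiguous.\<close>

definition op_rank :: "('a::complex_inner \<Rightarrow> 'b::complex_inner) \<Rightarrow> nat"
  where "op_rank F = complex_vector.dim (range F)"

text \<open>\<open>op_matrix2 P Q R S\<close> is the operator with rows \<open>P Q\<close> and \<open>R S\<close>.\<close>

definition op_matrix2 ::
  "('a \<Rightarrow> 'c) \<Rightarrow> ('b \<Rightarrow> 'c) \<Rightarrow> ('a \<Rightarrow> 'd) \<Rightarrow> ('b \<Rightarrow> 'd) \<Rightarrow>
    'a \<times> 'b \<Rightarrow> 'c::complex_inner \<times> 'd::complex_inner"
  where "op_matrix2 P Q R S = (\<lambda>(x, y). (P x + Q y, R x + S y))"

text \<open>Entries of the \<open>3 \<times> 3\<close> matrix of an operator on \<open>'a \<times> 'a \<times> 'a\<close>; indices are \<open>1, 2, 3\<close>.\<close>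

definition emb3 :: "nat \<Rightarrow> 'a::complex_inner \<Rightarrow> 'a \<times> 'a \<times> 'a"
  where "emb3 j h = (if j = 1 then h else 0, if j = 2 then h else 0, if j = 3 then h else 0)"

definition coord3 :: "nat \<Rightarrow> 'a \<times> 'a \<times> 'a \<Rightarrow> 'a"
  where "coord3 i = (\<lambda>(x, y, z). if i = 1 then x else if i = 2 then y else z)"

definition op_entry3 ::
  "('a::complex_inner \<times> 'a \<times> 'a \<Rightarrow> 'a \<times> 'a \<times> 'a) \<Rightarrow> nat \<Rightarrow> nat \<Rightarrow> 'a \<Rightarrow> 'a"
  where "op_entry3 Q i j = coord3 i \<circ> Q \<circ> emb3 j"

end

(*
  Conjugation by Z carries {T}' into {That}' and takes (h, 0, 0) to (V h, 0), where V h is nonzero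
  if h is. So the vectors Q_{3,1} h include the image of the dense set {T}' (V h, 0) under the third
  component of the inverse of Z. That component is continuous and onto, so this image is dense.
*)
theory Submission
  imports Defs
begin

text \<open>The class assumes homogeneity of the norm for real scalars only. For complex ones it
  comes from \<open>cinner_self\<close>: the scalar leaves the first slot as \<open>c\<close> and,
  through \<open>cinner_commute\<close>, the second as \<open>cnj c\<close>, which together give the
  square of \<open>cmod c\<close>.\<close>

lemma norm_scaleC: "norm (c *\<^sub>C x) = cmod c * norm x" for x :: "'a::complex_inner"
proof -
  have "cinner (c *\<^sub>C x) (c *\<^sub>C x) = c * cnj (cinner (c *\<^sub>C x) x)"
    by (metis cinner_scaleC_left cinner_commute)
  also have "\<dots> = c * cnj c * cnj (cinner x x)"
    by (simp add: cinner_scaleC_left)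
  also have "\<dots> = complex_of_real ((cmod c * norm x)\<^sup>2)"
    unfolding complex_norm_square[symmetric] by (simp add: cinner_self power_mult_distrib)
  finally have "(norm (c *\<^sub>C x))\<^sup>2 = (cmod c * norm x)\<^sup>2"
    unfolding cinner_self of_real_eq_iff .
  then show ?thesis
    by simp
qed

section \<open>Bounded complex-linear operators\<close>

lemma bounded_clinearD:
  assumes "bounded_clinear f"
  shows "bounded_linear f" "f (x + y) = f x + f y" "f (c *\<^sub>C x) = c *\<^sub>C f x" "f 0 = 0"
  using assms
  by (auto simp: bounded_clinear_def bounded_linear.linear linear_add linear_0)

lemma bounded_clinear_zero: "bounded_clinear (\<lambda>x. 0)"
  using complex_vector.scale_zero_right by (auto simp: bounded_clinear_def)

lemma bounded_clinear_ident: "bounded_clinear (\<lambda>x. x)"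
  by (simp add: bounded_clinear_def)

lemma bounded_clinear_fst: "bounded_clinear fst"
  by (simp add: bounded_clinear_def bounded_linear_fst scaleC_prod_def)

lemma bounded_clinear_snd: "bounded_clinear snd"
  by (simp add: bounded_clinear_def bounded_linear_snd scaleC_prod_def)

lemma bounded_clinear_Pair:
  assumes "bounded_clinear f" "bounded_clinear g"
  shows "bounded_clinear (\<lambda>x. (f x, g x))"
  using assms by (simp add: bounded_clinear_def bounded_linear_Pair scaleC_prod_def)

lemma bounded_clinear_add:
  assumes "bounded_clinear f" "bounded_clinear g"
  shows "bounded_clinear (\<lambda>x. f x + g x)"
  using assms by (simp add: bounded_clinear_def bounded_linear_add scaleC_add_right)

lemma bounded_clinear_comp:
  assumes "bounded_clinear f" "bounded_clinear g"
  shows "bounded_clinear (f \<circ> g)"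
  using assms by (auto simp: bounded_clinear_def comp_def intro: bounded_linear_compose)

lemma bounded_clinear_scaleC:
  assumes "bounded_clinear f"
  shows "bounded_clinear (\<lambda>x. c *\<^sub>C f x)"
proof -
  \<comment> \<open>Only the bound uses the inner product, through \<open>norm_scaleC\<close>.
    Compatibility with real scalars holds because \<open>scaleR\<close> is a special case of
    \<open>scaleC\<close> and complex multiplication commutes.\<close>
  have "bounded_linear (\<lambda>x :: 'b. c *\<^sub>C x)"
  proof (rule bounded_linear_intro)
    show "norm (c *\<^sub>C x) \<le> norm x * cmod c" for x :: 'b
      by (simp add: norm_scaleC mult.commute)
  qed (simp_all add: scaleC_add_right scaleR_scaleC scaleC_scaleC mult.commute)
  then have "bounded_clinear (\<lambda>x :: 'b. c *\<^sub>C x)"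
    by (simp add: bounded_clinear_def scaleC_scaleC mult.commute)
  from bounded_clinear_comp[OF this assms] show ?thesis
    by (simp add: comp_def)
qed

lemma bounded_clinear_diff_scaleC:
  assumes "bounded_clinear f"
  shows "bounded_clinear (\<lambda>x. f x - c *\<^sub>C x)"
proof -
  have "bounded_clinear (\<lambda>x. f x + (- c) *\<^sub>C x)"
    by (intro bounded_clinear_add bounded_clinear_scaleC assms bounded_clinear_ident)
  then show ?thesis
    by (simp add: complex_vector.scale_minus_left)
qed

lemma bounded_clinear_op_matrix2:
  assumes "bounded_clinear P" "bounded_clinear Q" "bounded_clinear R" "bounded_clinear S"
  shows "bounded_clinear (op_matrix2 P Q R S)"
proof -
  have "op_matrix2 P Q R S
      = (\<lambda>x. ((P \<circ> fst) x + (Q \<circ> snd) x, (R \<circ> fst) x + (S \<circ> snd) x))"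
    by (auto simp: op_matrix2_def)
  then show ?thesis
    by (simp only:) (intro bounded_clinear_Pair bounded_clinear_add bounded_clinear_comp
        bounded_clinear_fst bounded_clinear_snd assms)
qed

section \<open>Invertible operators and direct sums\<close>

lemma bounded_invertible_imp_bij: "bounded_invertible f \<Longrightarrow> bij f"
  by (auto simp: bounded_invertible_def intro: o_bij)

text \<open>The bounded two-sided inverse supplied by \<open>bounded_invertible\<close> is unique,
  so it is \<open>inv f\<close> itself.\<close>

lemma bounded_clinear_inv:
  assumes "bounded_invertible f"
  shows "bounded_clinear (inv f)"
proof -
  obtain g where "bounded_clinear g" "g \<circ> f = id" "f \<circ> g = id"
    using assms by (auto simp: bounded_invertible_def)
  then show ?thesis
    by (metis inv_unique_comp)
qed

lemma bounded_clinear_map_prod: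
  assumes "bounded_clinear f" "bounded_clinear g"
  shows "bounded_clinear (map_prod f g)"
proof -
  have "map_prod f g = (\<lambda>x. ((f \<circ> fst) x, (g \<circ> snd) x))"
    by (auto simp: fun_eq_iff)
  then show ?thesis
    by (simp only:) (intro bounded_clinear_Pair bounded_clinear_comp
        bounded_clinear_fst bounded_clinear_snd assms)
qed

lemma bounded_invertible_map_prod:
  assumes "bounded_invertible f" "bounded_invertible g"
  shows "bounded_invertible (map_prod f g)"
proof -
  obtain f' where f': "bounded_clinear f'" "f' \<circ> f = id" "f \<circ> f' = id"
    using assms(1) by (auto simp: bounded_invertible_def)
  obtain g' where g': "bounded_clinear g'" "g' \<circ> g = id" "g \<circ> g' = id"
    using assms(2) by (auto simp: bounded_invertible_def)
  have "map_prod f' g' \<circ> map_prod f g = id" "map_prod f g \<circ> map_prod f' g' = id"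
    using f' g' by (simp_all add: map_prod.comp map_prod.id)
  moreover have "bounded_clinear (map_prod f g)" "bounded_clinear (map_prod f' g')"
    using assms f'(1) g'(1) by (auto simp: bounded_invertible_def intro: bounded_clinear_map_prod)
  ultimately show ?thesis
    unfolding bounded_invertible_def by (intro conjI exI[of _ "map_prod f' g'"])
qed

lemma bounded_clinear_emb3: "bounded_clinear (emb3 j)"
proof -
  \<comment> \<open>The tests on \<open>j\<close> do not depend on the vector, so each coordinate of
    \<open>emb3 j\<close> is either the identity or zero.\<close>
  have "bounded_clinear (\<lambda>h. if P then h else 0)" for P
    by (cases P) (simp_all add: bounded_clinear_zero bounded_clinear_ident)
  then show ?thesis
    unfolding emb3_def[abs_def] by (intro bounded_clinear_Pair)
qed

lemma bounded_clinear_coord3: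
  "bounded_clinear (coord3 i :: 'a::complex_inner \<times> 'a \<times> 'a \<Rightarrow> 'a)"
proof -
  have "(coord3 i :: 'a \<times> 'a \<times> 'a \<Rightarrow> 'a)
      = (if i = 1 then fst else if i = 2 then fst \<circ> snd else snd \<circ> snd)"
    by (auto simp: coord3_def)
  then show ?thesis
    by (simp add: bounded_clinear_comp bounded_clinear_fst bounded_clinear_snd)
qed

section \<open>Linear manifolds of operators and commutants\<close>

lemma op_linear_manifold_commutant:
  assumes "bounded_clinear R"
  shows "op_linear_manifold (commutant R)"
  unfolding op_linear_manifold_def commutant_def
  by (auto simp: fun_eq_iff bounded_clinearD[OF assms] bounded_clinear_zero bounded_clinear_add
      bounded_clinear_scaleC)

text \<open>Sums and multiples of operators are pointwise, so they pass through \<open>R\<close> by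
  substitution and through \<open>L\<close> by its linearity. Matrix entries are the case where
  \<open>L\<close> is a coordinate and \<open>R\<close> an embedding.\<close>

lemma op_linear_manifold_compress:
  assumes "op_linear_manifold N" and L: "bounded_clinear L" and R: "bounded_clinear R"
  shows "op_linear_manifold {L \<circ> Q \<circ> R | Q. Q \<in> N}"
proof -
  have bdd: "bounded_clinear Q" if "Q \<in> N" for Q
    using assms(1) that by (auto simp: op_linear_manifold_def)
  have zero: "(\<lambda>x. 0) \<in> N"
    and add: "P \<in> N \<Longrightarrow> Q \<in> N \<Longrightarrow> (\<lambda>x. P x + Q x) \<in> N"
    and scale: "Q \<in> N \<Longrightarrow> (\<lambda>x. c *\<^sub>C Q x) \<in> N" for P Q c
    using assms(1) by (auto simp: op_linear_manifold_def)
  have "(\<lambda>x. 0) = L \<circ> (\<lambda>x. 0) \<circ> R"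
    "(\<lambda>x. (L \<circ> P \<circ> R) x + (L \<circ> Q \<circ> R) x) = L \<circ> (\<lambda>x. P x + Q x) \<circ> R"
    "(\<lambda>x. c *\<^sub>C (L \<circ> Q \<circ> R) x) = L \<circ> (\<lambda>x. c *\<^sub>C Q x) \<circ> R" for P Q c
    by (simp_all add: fun_eq_iff bounded_clinearD[OF L])
  then show ?thesis
    unfolding op_linear_manifold_def
    using zero add scale bounded_clinear_comp[OF bounded_clinear_comp[OF L bdd] R] by blast
qed

text \<open>A complex-linear operator commutes with every scalar multiple of the identity. This
  accounts for the shift by \<open>\<mu> 0\<close> inside \<open>That\<close>.\<close>

lemma commutant_subset_commutant_diff_scaleC:
  "commutant R \<subseteq> commutant (\<lambda>x. R x - c *\<^sub>C x)"
proof
  fix Q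
  assume Q: "Q \<in> commutant R"
  then have lin: "bounded_clinear Q" and comm: "Q (R x) = R (Q x)" for x
    by (auto simp: commutant_def fun_eq_iff)
  have "Q (R x - c *\<^sub>C x) = R (Q x) - c *\<^sub>C Q x" for x
    using linear_diff[OF bounded_linear.linear[OF bounded_clinearD(1)[OF lin]]]
    by (simp add: comm bounded_clinearD(3)[OF lin])
  with lin show "Q \<in> commutant (\<lambda>x. R x - c *\<^sub>C x)"
    by (simp add: commutant_def fun_eq_iff)
qed

text \<open>In a product of two conjugates the inner \<open>Z \<circ> inv Z\<close> cancels, so both
  orders reduce to the conjugate of \<open>Q \<circ> R = R \<circ> Q\<close>.\<close>

lemma conjugate_in_commutant:
  assumes "bounded_invertible Z" "Q \<in> commutant R"
  shows "inv Z \<circ> Q \<circ> Z \<in> commutant (inv Z \<circ> R \<circ> Z)"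
proof -
  have "Z (inv Z x) = x" for x
    by (rule surj_f_inv_f) (use assms(1) in \<open>auto dest: bounded_invertible_imp_bij bij_is_surj\<close>)
  with assms show ?thesis
    by (auto simp: commutant_def fun_eq_iff bounded_invertible_def[of Z]
        intro!: bounded_clinear_comp bounded_clinear_inv)
qed

lemma closure_image_eq_UNIV:
  assumes "continuous_on UNIV f" "surj f" "closure S = UNIV"
  shows "closure (f ` S) = UNIV"
  using image_closure_subset[of S f "closure (f ` S)"] closure_subset[of "f ` S"] assms by auto

theorem proposition8:
  fixes e :: "nat \<Rightarrow> 'h::complex_hilbert"
    and A :: "'h1::complex_hilbert \<Rightarrow> 'h1"
    and B :: "'h2::complex_hilbert \<Rightarrow> 'h2"
    and C :: "'h2 \<Rightarrow> 'h1"
    and T :: "'h1 \<times> 'h2 \<Rightarrow> 'h1 \<times> 'h2"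
    and S F D X Y :: "'h \<Rightarrow> 'h"
    and V :: "'h \<Rightarrow> 'h1"
    and W :: "'h \<times> 'h \<Rightarrow> 'h2"
    and Z :: "'h \<times> 'h \<times> 'h \<Rightarrow> 'h1 \<times> 'h2"
    and Bhat :: "'h \<times> 'h \<Rightarrow> 'h \<times> 'h"
    and That :: "'h \<times> 'h \<times> 'h \<Rightarrow> 'h \<times> 'h \<times> 'h"
    and \<mu> :: "nat \<Rightarrow> complex"
  assumes "\<exists>b :: nat \<Rightarrow> 'h1. orthonormal_basis UNIV b"
    and "\<exists>b :: nat \<Rightarrow> 'h2. orthonormal_basis UNIV b"
    and "orthonormal_basis {1..} e"
    and "bounded_clinear A" "bounded_clinear B" "bounded_clinear C"
    and "T = op_matrix2 A C (\<lambda>x. 0) B"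
    and "S = unilateral_shift e"
    and "bounded_invertible V" "V \<circ> S = A \<circ> V"
    and "\<mu> 0 \<in> frontier (op_spectrum B)"
    and "inj_on \<mu> {1..}"
    and "\<And>k. k \<ge> 1 \<Longrightarrow> \<mu> k \<noteq> 0"
    and "\<And>k. k \<ge> 1 \<Longrightarrow> \<mu> k \<in> resolvent_set B"
    and "\<mu> \<longlonglongrightarrow> \<mu> 0"
    and "bounded_clinear X" "bounded_clinear Y" "bounded_clinear F"
    and "op_rank F = 1"
    and "D = diagonal_op e (\<lambda>k. \<mu> k - \<mu> 0)"
    and "Bhat = op_matrix2 X Y F D"
    and "bounded_invertible W" "W \<circ> Bhat = (\<lambda>y. B y - \<mu> 0 *\<^sub>C y) \<circ> W"
    and "Z = map_prod V W"
    and "That = inv Z \<circ> (\<lambda>p. T p - \<mu> 0 *\<^sub>C p) \<circ> Z"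
    and "\<And>x :: 'h1. x \<noteq> 0 \<Longrightarrow> closure {Q (x, 0) | Q. Q \<in> commutant T} = UNIV"
  shows "transitive_manifold {op_entry3 Q 3 1 | Q. Q \<in> commutant That}"
proof -
  note V = assms(9) and Z = \<open>Z = map_prod V W\<close> and dense = assms(26)
  note That = \<open>That = inv Z \<circ> (\<lambda>p. T p - \<mu> 0 *\<^sub>C p) \<circ> Z\<close>
  have invZ: "bounded_invertible Z"
    unfolding Z by (intro bounded_invertible_map_prod V \<open>bounded_invertible W\<close>)
  have "bounded_clinear T"
    unfolding \<open>T = _\<close> by (intro bounded_clinear_op_matrix2 assms bounded_clinear_zero)
  then have "bounded_clinear That"
    unfolding That using invZ
    by (intro bounded_clinear_comp bounded_clinear_inv bounded_clinear_diff_scaleC)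
      (simp_all add: bounded_invertible_def)
  \<comment> \<open>The (3,1) entry of \<open>Q\<close> is the compression of \<open>Q\<close> by
    \<open>coord3 3\<close> on the left and \<open>emb3 1\<close> on the right.\<close>
  then have manifold: "op_linear_manifold {op_entry3 Q 3 1 | Q. Q \<in> commutant That}"
    unfolding op_entry3_def
    by (intro op_linear_manifold_compress op_linear_manifold_commutant bounded_clinear_coord3
        bounded_clinear_emb3)
  have "closure {P h | P. P \<in> {op_entry3 Q 3 1 | Q. Q \<in> commutant That}} = UNIV"
    if "h \<noteq> 0" for h
  proof -
    have "bounded_clinear V"
      using V by (simp add: bounded_invertible_def)
    \<comment> \<open>\<open>V\<close> is injective and sends 0 to 0, so the density hypothesis
      applies at \<open>V h\<close>.\<close>
    then have "V h \<noteq> 0"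
      using bij_is_inj[OF bounded_invertible_imp_bij[OF V]] that
      by (metis bounded_clinearD(4) injD)
    have "bounded_clinear W"
      using \<open>bounded_invertible W\<close> by (simp add: bounded_invertible_def)
    \<comment> \<open>The last two coordinates of \<open>emb3 1 h\<close> form the zero of
      \<open>'h \<times> 'h\<close>, which \<open>W\<close> sends to 0.\<close>
    then have Z_emb: "Z (emb3 1 h) = (V h, 0)"
      using bounded_clinearD(4)[of W] by (simp add: Z emb3_def zero_prod_def)
    \<comment> \<open>Reading off the third coordinate after \<open>inv Z\<close> turns a vector
      \<open>Q (V h, 0)\<close> into the value at \<open>h\<close> of a (3,1) entry.\<close>
    define g where "g = coord3 3 \<circ> inv Z"
    have "bounded_clinear g"
      unfolding g_def by (intro bounded_clinear_comp bounded_clinear_coord3 bounded_clinear_inv invZ)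
    then have "continuous_on UNIV g"
      by (intro linear_continuous_on bounded_clinearD(1))
    moreover have "surj (coord3 3 :: 'h \<times> 'h \<times> 'h \<Rightarrow> 'h)"
      by (rule surjI[of _ "emb3 3"]) (simp add: coord3_def emb3_def)
    then have "surj g"
      unfolding g_def
      by (rule comp_surj[OF bij_is_surj[OF bij_imp_bij_inv[OF bounded_invertible_imp_bij[OF invZ]]]])
    ultimately have "closure (g ` {Q (V h, 0) | Q. Q \<in> commutant T}) = UNIV"
      using closure_image_eq_UNIV dense[OF \<open>V h \<noteq> 0\<close>] by blast
    \<comment> \<open>An inclusion suffices: a set that contains a dense set is dense.\<close>
    moreover have "g ` {Q (V h, 0) | Q. Q \<in> commutant T}
        \<subseteq> {P h | P. P \<in> {op_entry3 Q 3 1 | Q. Q \<in> commutant That}}"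
    proof (rule image_subsetI)
      fix y
      assume "y \<in> {Q (V h, 0) | Q. Q \<in> commutant T}"
      then obtain Q where "y = Q (V h, 0)" and "Q \<in> commutant T"
        by blast
      from \<open>Q \<in> commutant T\<close> have "inv Z \<circ> Q \<circ> Z \<in> commutant That"
        unfolding That
        using conjugate_in_commutant[OF invZ] commutant_subset_commutant_diff_scaleC by blast
      \<comment> \<open>By \<open>Z_emb\<close>, the vector \<open>(V h, 0)\<close> is
        \<open>Z (emb3 1 h)\<close>, so both sides are \<open>coord3 3\<close> of
        \<open>inv Z (Q (Z (emb3 1 h)))\<close>.\<close>
      moreover have "g y = op_entry3 (inv Z \<circ> Q \<circ> Z) 3 1 h"
        by (simp only: \<open>y = _\<close> op_entry3_def g_def comp_apply Z_emb)
      ultimately show "g y \<in> {P h | P. P \<in> {op_entry3 Q 3 1 | Q. Q \<in> commutant That}}"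
        by blast
    qed
    ultimately show ?thesis
      using closure_mono by blast
  qed
  with manifold show ?thesis
    unfolding transitive_manifold_def by blast
qed

end
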